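(* Let $F$ be a field of characteristic two and let $(A,\sigma)$ be a totally decomposable central simple $F$-algebra with anisotropic orthogonal involution. Then every $x\in\mathrm{Sym}(A,\sigma)^+$ is contained in a $\sigma$-invariant quaternion subalgebra of $A$.
   Context: Involutions are of the first kind. $(A,\sigma)$ is totally decomposable if it is isomorphic to a tensor product of quaternion $F$-algebras with involution. $\sigma$ is anisotropic if $\sigma(x)x=0$ implies $x=0$. $\mathrm{Sym}(A,\sigma)^+=\{x\in A\mid \sigma(x)=x,\ x^2\in F\}$. A $\sigma$-invariant quaternion subalgebra is an $F$-subalgebra $Q\subseteq A$ which is a quaternion $F$-algebra and satisfies $\sigma(Q)=Q$. *)

theory Defs
  imports Main "HOL.Vector_Spaces"
begin

definition is_algebra :: "('f::field \<Rightarrow> 'a::ring_1 \<Rightarrow> 'a) \<Rightarrow> bool" where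
  "is_algebra smult \<longleftrightarrow> vector_space smult \<and>
     (\<forall>c x y. smult c (x * y) = smult c x * y) \<and>
     (\<forall>c x y. smult c (x * y) = x * smult c y)"

definition subalgebra :: "('f::field \<Rightarrow> 'a::ring_1 \<Rightarrow> 'a) \<Rightarrow> 'a set \<Rightarrow> bool" where
  "subalgebra smult S \<longleftrightarrow> module.subspace smult S \<and> 1 \<in> S \<and>
     (\<forall>x\<in>S. \<forall>y\<in>S. x * y \<in> S)"

definition two_sided_ideal_of :: "'a::ring_1 set \<Rightarrow> 'a set \<Rightarrow> bool" where
  "two_sided_ideal_of S I \<longleftrightarrow> I \<subseteq> S \<and> 0 \<in> I \<and>
     (\<forall>x\<in>I. \<forall>y\<in>I. x + y \<in> I) \<and> (\<forall>x\<in>I. - x \<in> I) \<and>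
     (\<forall>s\<in>S. \<forall>x\<in>I. s * x \<in> I \<and> x * s \<in> I)"

definition central_simple_sub :: "('f::field \<Rightarrow> 'a::ring_1 \<Rightarrow> 'a) \<Rightarrow> 'a set \<Rightarrow> bool" where
  "central_simple_sub smult S \<longleftrightarrow> subalgebra smult S \<and>
     (\<exists>B. finite B \<and> B \<subseteq> S \<and> module.span smult B = S) \<and>
     {z\<in>S. \<forall>y\<in>S. z * y = y * z} = range (\<lambda>c. smult c 1) \<and>
     (\<forall>I. two_sided_ideal_of S I \<longrightarrow> I = {0} \<or> I = S)"

definition quaternion_sub :: "('f::field \<Rightarrow> 'a::ring_1 \<Rightarrow> 'a) \<Rightarrow> 'a set \<Rightarrow> bool" where
  "quaternion_sub smult Q \<longleftrightarrow> central_simple_sub smult Q \<and> vector_space.dim smult Q = 4"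

definition involution_first_kind :: "('f::field \<Rightarrow> 'a::ring_1 \<Rightarrow> 'a) \<Rightarrow> ('a \<Rightarrow> 'a) \<Rightarrow> bool" where
  "involution_first_kind smult \<sigma> \<longleftrightarrow>
     (\<forall>x y. \<sigma> (x + y) = \<sigma> x + \<sigma> y) \<and>
     (\<forall>x y. \<sigma> (x * y) = \<sigma> y * \<sigma> x) \<and>
     (\<forall>x. \<sigma> (\<sigma> x) = x) \<and>
     (\<forall>c. \<sigma> (smult c 1) = smult c 1)"

text \<open>Orthogonal involution in characteristic two: 1 is not in Alt(A,sigma) = {y + sigma y}
  (equivalently, sigma is not symplectic).\<close>
definition orthogonal_char2 :: "('a::ring_1 \<Rightarrow> 'a) \<Rightarrow> bool" where
  "orthogonal_char2 \<sigma> \<longleftrightarrow> \<not> (\<exists>y. y + \<sigma> y = 1)"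

definition anisotropic :: "('a::ring_1 \<Rightarrow> 'a) \<Rightarrow> bool" where
  "anisotropic \<sigma> \<longleftrightarrow> (\<forall>x. \<sigma> x * x = 0 \<longrightarrow> x = 0)"

definition Sym_plus :: "('f::field \<Rightarrow> 'a::ring_1 \<Rightarrow> 'a) \<Rightarrow> ('a \<Rightarrow> 'a) \<Rightarrow> 'a set" where
  "Sym_plus smult \<sigma> = {x. \<sigma> x = x \<and> (\<exists>c. x * x = smult c 1)}"

definition generated_subalgebra :: "('f::field \<Rightarrow> 'a::ring_1 \<Rightarrow> 'a) \<Rightarrow> 'a set \<Rightarrow> 'a set" where
  "generated_subalgebra smult X = \<Inter> {S. subalgebra smult S \<and> X \<subseteq> S}"

text \<open>(A,sigma) is totally decomposable: A is the internal tensor product of n >= 1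
  pairwise commuting sigma-invariant quaternion subalgebras Q_0,...,Q_{n-1}
  (they generate A and dim A = 4^n, so the multiplication map
  Q_0 (x) ... (x) Q_{n-1} -> A is an isomorphism, under which sigma corresponds to
  the tensor product of the restrictions sigma|Q_i).\<close>
definition totally_decomposable :: "('f::field \<Rightarrow> 'a::ring_1 \<Rightarrow> 'a) \<Rightarrow> ('a \<Rightarrow> 'a) \<Rightarrow> bool" where
  "totally_decomposable smult \<sigma> \<longleftrightarrow>
     (\<exists>n::nat. \<exists>Q::nat \<Rightarrow> 'a set. n \<ge> 1 \<and>
        (\<forall>i<n. quaternion_sub smult (Q i) \<and> \<sigma> ` Q i = Q i) \<and>
        (\<forall>i<n. \<forall>j<n. i \<noteq> j \<longrightarrow> (\<forall>x\<in>Q i. \<forall>y\<in>Q j. x * y = y * x)) \<and>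
        generated_subalgebra smult (\<Union>i<n. Q i) = UNIV \<and>
        vector_space.dim smult (UNIV :: 'a set) = 4 ^ n)"

end

theory Submission
  imports Defs
begin

text \<open>
  Each quaternion factor is \<open>F[u\<^sub>i, v\<^sub>i]\<close> with \<open>u\<^sub>i\<close>, \<open>v\<^sub>i\<close> symmetric, \<open>u\<^sub>i\<^sup>2 + u\<^sub>i\<close> and \<open>v\<^sub>i\<^sup>2\<close> in \<open>F\<close>,
  and \<open>u\<^sub>i v\<^sub>i + v\<^sub>i u\<^sub>i = v\<^sub>i\<close>. The involution is the identity on the field \<open>K = F[v\<^sub>0, \<dots>, v\<^sub>n\<^sub>-\<^sub>1]\<close>, which
  is its own centralizer. Adjoining the \<open>u\<^sub>i\<close> to \<open>K\<close> one at a time shows that anisotropy improves to: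
  \<open>\<sigma> y y = z + \<sigma> z\<close> only for \<open>y = 0\<close>. Applied to the commutators \<open>y\<close> of \<open>x \<in> Sym\<^sup>+\<close> with the \<open>v\<^sub>i\<close>, this
  gives \<open>x \<in> K\<close>. After subtracting a scalar, \<open>x\<close> lies in the span of the nonempty products of the
  \<open>v\<^sub>i\<close>, and the argument of the pure subform theorem for Pfister forms yields a symmetric \<open>w\<close> with
  \<open>w\<^sup>2 + w \<in> F\<close> and \<open>w x + x w = x\<close>, so that \<open>w\<close> and \<open>x\<close> generate the required subalgebra.
\<close>

section \<open>Commutator calculus for an anisotropic involution in characteristic two\<close>

locale char2_involution = vector_space smult
  for smult :: "'f::field \<Rightarrow> 'a::ring_1 \<Rightarrow> 'a" +
  fixes \<sigma> :: "'a \<Rightarrow> 'a"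
  assumes char2: "CHAR('f) = 2"
    and alg: "is_algebra smult"
    and invol: "involution_first_kind smult \<sigma>"
    and aniso: "anisotropic \<sigma>"
begin

text \<open>In characteristic two this is the commutator, so \<open>br u\<close> is a derivation and
  \<open>br x y = 0\<close> means that \<open>x\<close> and \<open>y\<close> commute.\<close>

definition br :: "'a \<Rightarrow> 'a \<Rightarrow> 'a" where
  "br x y = x * y + y * x"

text \<open>For a subalgebra \<open>S\<close> this is the right \<open>S\<close>-module
  \<open>S + w S\<close>; \<open>subalgebra_adjoin\<close> says when it is a ring.\<close>

definition adjoin :: "'a \<Rightarrow> 'a set \<Rightarrow> 'a set" where
  "adjoin w S = {p + w * s | p s. p \<in> S \<and> s \<in> S}"

text \<open>A strengthening of anisotropy: \<open>\<sigma> y * y\<close> may not even be alternating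
  unless \<open>y = 0\<close>. The witness \<open>z\<close> also ranges over \<open>S\<close>, so
  where \<open>\<sigma>\<close> is the identity on \<open>S\<close> this reduces to anisotropy on
  \<open>S\<close>.\<close>

definition direct_on :: "'a set \<Rightarrow> bool" where
  "direct_on S \<longleftrightarrow> (\<forall>y\<in>S. \<forall>z\<in>S. \<sigma> y * y = z + \<sigma> z \<longrightarrow> y = 0)"

text \<open>Scalars as elements of the algebra, so that they take part in ring computations.\<close>

definition F :: "'a set" where "F = range (\<lambda>c. smult c 1)"

lemma add_self [simp]: "(x::'a) + x = 0"
proof -
  have "(1::'f) + 1 = 0"
    using of_nat_CHAR[where 'a='f] char2 by simp
  then have "smult (1 + 1) x = 0" by simp
  then show ?thesis by (simp only: scale_left_distrib scale_one)
qed

lemma add_self_left [simp]: "(x::'a) + (x + y) = y"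
  by (simp add: add.assoc[symmetric])

lemma uminus_char2 [simp]: "- (x::'a) = x"
  by (rule minus_unique) simp

lemma diff_char2 [simp]: "(x::'a) - y = x + y"
  by (simp add: diff_conv_add_uminus del: add_uminus_conv_diff)

lemma add_eq_0_iff_char2: "(x::'a) + y = 0 \<longleftrightarrow> x = y"
  by (metis add_self add_self_left add_0_right)

lemma add_eq_iff_char2: "(x::'a) + y = z \<longleftrightarrow> x = y + z"
  by (metis add_self_left add.commute)

lemmas c2_simps = distrib_left distrib_right mult.assoc add_ac

lemma smult_eq: "smult c x = smult c 1 * x"
  using alg unfolding is_algebra_def by (metis mult_1)

lemma F_commute: assumes "c \<in> F" shows "x * c = c * x"
proof -
  obtain k where "c = smult k 1" using assms unfolding F_def by auto
  then show ?thesis using alg unfolding is_algebra_def by (metis mult_1 mult_1_right)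
qed

lemma F_add: "c \<in> F \<Longrightarrow> d \<in> F \<Longrightarrow> c + d \<in> F"
  unfolding F_def by (auto simp flip: scale_left_distrib)

lemma F_mult: "c \<in> F \<Longrightarrow> d \<in> F \<Longrightarrow> c * d \<in> F"
  unfolding F_def by (auto simp flip: smult_eq)

lemma F_0: "0 \<in> F" and F_1: "1 \<in> F"
  unfolding F_def by (metis rangeI scale_zero_left, metis rangeI scale_one)

lemma smult_1_in_F: "smult c 1 \<in> F"
  unfolding F_def by simp

lemma F_inverse:
  assumes "c \<in> F" "c \<noteq> 0"
  obtains e where "e \<in> F" "c * e = 1" "e * c = 1"
proof -
  obtain k where k: "c = smult k 1" using assms unfolding F_def by auto
  with assms have "k \<noteq> 0" by auto
  then have "c * smult (inverse k) 1 = 1"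
    using k by (simp flip: smult_eq)
  moreover have "smult (inverse k) 1 \<in> F" by (rule smult_1_in_F)
  ultimately show thesis using that F_commute by metis
qed

lemma F_cancel: "c \<in> F \<Longrightarrow> c \<noteq> 0 \<Longrightarrow> c * x = 0 \<Longrightarrow> x = 0"
  by (metis F_inverse mult.assoc mult_1 mult_zero_right)

lemma \<sigma>_add [simp]: "\<sigma> (x + y) = \<sigma> x + \<sigma> y"
  and \<sigma>_mult [simp]: "\<sigma> (x * y) = \<sigma> y * \<sigma> x"
  and \<sigma>_\<sigma> [simp]: "\<sigma> (\<sigma> x) = x"
  using invol unfolding involution_first_kind_def by auto

lemma \<sigma>_F: "c \<in> F \<Longrightarrow> \<sigma> c = c"
  using invol unfolding involution_first_kind_def F_def by auto

lemma \<sigma>_1 [simp]: "\<sigma> 1 = 1" and \<sigma>_0 [simp]: "\<sigma> 0 = 0"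
  using \<sigma>_F F_0 F_1 by auto

lemma sym_square_nonzero: "\<sigma> y = y \<Longrightarrow> y \<noteq> 0 \<Longrightarrow> y * y \<noteq> 0"
  using aniso unfolding anisotropic_def by metis

text \<open>The inverse of \<open>y\<close> is \<open>y * e\<close> with \<open>e\<close> the
  inverse of the scalar \<open>y * y\<close>, which is nonzero by anisotropy.\<close>

lemma sym_inverse:
  assumes "\<sigma> y = y" "y \<noteq> 0" "y * y \<in> F"
  obtains e where "e \<in> F" "y * (y * e) = 1" "y * e * y = 1"
proof -
  obtain e where "e \<in> F" "y * y * e = 1"
    using F_inverse[OF assms(3) sym_square_nonzero[OF assms(1,2)]] by metis
  then show thesis
    using that F_commute[of e y] by (metis mult.assoc)
qed

lemma br_add: "br x (y + z) = br x y + br x z" "br (x + y) z = br x z + br y z"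
  by (simp_all add: br_def c2_simps)

lemma br_mult: "br u (x * y) = br u x * y + x * br u y"
  by (simp add: br_def c2_simps)

lemma br_mult_left: "br (x * y) u = br x u * y + x * br y u"
  by (simp add: br_def c2_simps)

text \<open>In \<open>br u (br u x)\<close> the term \<open>u * x * u\<close> occurs twice and
  cancels. Hence \<open>br u\<close> is idempotent if \<open>u * u + u\<close> is a scalar, and
  squares to zero if \<open>u * u\<close> is one.\<close>

lemma br_square: "br (u * u) x = br u (br u x)"
  by (simp add: br_def c2_simps)

lemma br_F: "c \<in> F \<Longrightarrow> br c x = 0" "c \<in> F \<Longrightarrow> br x c = 0"
  by (simp_all add: br_def F_commute)

lemma br_eq_0_iff: "br x y = 0 \<longleftrightarrow> x * y = y * x"
  by (simp add: br_def add_eq_0_iff_char2)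

lemma br_commute: "br x y = br y x"
  by (simp add: br_def add.commute)

lemma \<sigma>_br: "\<sigma> (br x y) = br (\<sigma> x) (\<sigma> y)"
  by (simp add: br_def add.commute)

lemma br_self [simp]: "br x x = 0"
  by (simp add: br_def)

lemma br_0 [simp]: "br x 0 = 0" "br 0 x = 0"
  by (simp_all add: br_def)

section \<open>Subalgebras, adjunction and spans\<close>

lemma subalgebra_iff:
  "subalgebra smult S \<longleftrightarrow> F \<subseteq> S \<and> (\<forall>x\<in>S. \<forall>y\<in>S. x + y \<in> S \<and> x * y \<in> S)"
proof
  assume S: "subalgebra smult S"
  then have "smult c 1 \<in> S" for c
    unfolding subalgebra_def using subspace_scale by auto
  then show "F \<subseteq> S \<and> (\<forall>x\<in>S. \<forall>y\<in>S. x + y \<in> S \<and> x * y \<in> S)"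
    using S unfolding F_def subalgebra_def by (auto intro: subspace_add)
next
  assume S: "F \<subseteq> S \<and> (\<forall>x\<in>S. \<forall>y\<in>S. x + y \<in> S \<and> x * y \<in> S)"
  have "smult c x \<in> S" if "x \<in> S" for c x
    using S smult_1_in_F that by (metis smult_eq subset_iff)
  then have "subspace S"
    using S F_0 by (intro subspaceI) auto
  then show "subalgebra smult S"
    using S F_1 unfolding subalgebra_def by auto
qed

lemma subalgebraD:
  assumes "subalgebra smult S"
  shows "c \<in> F \<Longrightarrow> c \<in> S" "0 \<in> S" "1 \<in> S"
    "x \<in> S \<Longrightarrow> y \<in> S \<Longrightarrow> x + y \<in> S" "x \<in> S \<Longrightarrow> y \<in> S \<Longrightarrow> x * y \<in> S"
  using assms F_0 F_1 unfolding subalgebra_iff by auto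

lemma adjoinI: "p \<in> S \<Longrightarrow> s \<in> S \<Longrightarrow> p + w * s \<in> adjoin w S"
  unfolding adjoin_def by auto

lemma subset_adjoin: assumes "subalgebra smult S" shows "S \<subseteq> adjoin w S"
  using adjoinI[of _ S 0 w] subalgebraD(2)[OF assms] by force

lemma generator_in_adjoin: assumes "subalgebra smult S" shows "w \<in> adjoin w S"
  using adjoinI[of 0 S 1 w] subalgebraD(2,3)[OF assms] by simp

text \<open>Hypothesis \<open>D\<close> moves \<open>w\<close> to the left past elements of
  \<open>S\<close>, and \<open>w(1)\<close> lowers \<open>w * w\<close> to degree one, so products
  return to the form \<open>p + w * s\<close>.\<close>

lemma subalgebra_adjoin:
  assumes S: "subalgebra smult S"
    and D: "\<And>s. s \<in> S \<Longrightarrow> br w s \<in> S"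
    and w: "w * w = a + w * b" "a \<in> S" "b \<in> S"
  shows "subalgebra smult (adjoin w S)"
  unfolding subalgebra_iff
proof (intro conjI ballI)
  show "F \<subseteq> adjoin w S" using subset_adjoin[OF S] subalgebraD(1)[OF S] by blast
  fix x y assume "x \<in> adjoin w S" "y \<in> adjoin w S"
  then obtain p s q t where xy: "x = p + w * s" "y = q + w * t"
    and mem: "p \<in> S" "s \<in> S" "q \<in> S" "t \<in> S"
    unfolding adjoin_def by auto
  have "x + y = (p + q) + w * (s + t)" by (simp add: xy c2_simps)
  then show "x + y \<in> adjoin w S"
    using adjoinI subalgebraD[OF S] mem by metis
  have "x * y = (p * q + br w p * t + a * (s * t)) + w * (p * t + s * q + br w s * t + b * (s * t))"
  proof -
    have "x * y = p * q + w * s * q + p * w * t + w * (s * w) * t"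
      by (simp add: xy c2_simps)
    also have "p * w = w * p + br w p" by (simp add: br_def c2_simps)
    also have "s * w = w * s + br w s" by (simp add: br_def c2_simps)
    also have "w * (w * s + br w s) = (a + w * b) * s + w * br w s"
      by (simp add: w(1)[symmetric] c2_simps)
    finally show ?thesis by (simp add: c2_simps)
  qed
  then show "x * y \<in> adjoin w S"
    using adjoinI subalgebraD[OF S] mem D w by auto
qed

lemma span_insert_F:
  "y \<in> span (insert x S) \<longleftrightarrow> (\<exists>c\<in>F. \<exists>z\<in>span S. y = z + c * x)"
proof
  assume "y \<in> span (insert x S)"
  then obtain k where "y - smult k x \<in> span S" unfolding span_insert by auto
  then show "\<exists>c\<in>F. \<exists>z\<in>span S. y = z + c * x"
    by (intro bexI[of _ "smult k 1"] bexI[of _ "y - smult k x"])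
      (auto simp: smult_eq[symmetric] smult_1_in_F add.assoc)
next
  assume "\<exists>c\<in>F. \<exists>z\<in>span S. y = z + c * x"
  then obtain c z where cz: "c \<in> F" "z \<in> span S" "y = z + c * x" by auto
  then obtain k where k: "c * x = smult k x" unfolding F_def by (metis imageE smult_eq)
  have "y - smult k x = z" unfolding cz(3) k by (simp add: add.assoc)
  then show "y \<in> span (insert x S)"
    using cz(2) unfolding span_insert by auto
qed

lemma span_1: "span {1} = F"
  using span_singleton F_def by auto

lemma span_1_x: "y \<in> span {x, 1} \<longleftrightarrow> (\<exists>a\<in>F. \<exists>b\<in>F. y = a + b * x)"
  unfolding span_insert_F[of y x] span_1 by auto

lemma independent_spans:
  assumes "independent B" "finite B" "card B = dim V" "subspace V" "B \<subseteq> V" "dim V > 0"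
  shows "span B = V"
proof
  show "span B \<subseteq> V" using assms span_minimal by auto
  show "V \<subseteq> span B"
  proof (rule subsetI, rule ccontr)
    fix w assume w: "w \<in> V" "w \<notin> span B"
    obtain C where C: "C \<subseteq> V" "independent C" "V \<subseteq> span C" "card C = dim V"
      by (rule basis_exists)
    \<comment> \<open>\<open>card\<close> is 0 on infinite sets, so positive dimension forces the
      basis \<open>C\<close> to be finite.\<close>
    have "finite C" using C(4) assms(6) card_ge_0_finite by metis
    moreover have "independent (insert w B)"
      using independent_insertI[OF w(2) assms(1)] .
    moreover have "insert w B \<subseteq> span C" using w C(3) assms(5) by auto
    ultimately have "card (insert w B) \<le> card C"
      using independent_span_bound by blast
    moreover have "w \<notin> B" using w(2) span_base by auto
    ultimately show False using assms(2,3) C(4) by simp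
  qed
qed

section \<open>Structure of quaternion algebras with involution\<close>

lemma quaternion_sub_D:
  assumes "quaternion_sub smult Q"
  shows "subalgebra smult Q" "dim Q = 4"
    "\<And>x. x \<in> Q \<Longrightarrow> (\<And>y. y \<in> Q \<Longrightarrow> x * y = y * x) \<Longrightarrow> x \<in> F"
    "\<And>I. two_sided_ideal_of Q I \<Longrightarrow> I = {0} \<or> I = Q"
  using assms unfolding quaternion_sub_def central_simple_sub_def F_def by blast+

text \<open>Otherwise \<open>C = F + F x + F y\<close> is commutative of codimension one in \<open>Q\<close>, so some
  nonzero \<open>z = x + l\<close> satisfies \<open>z Q \<subseteq> C\<close>; simplicity then forces this right ideal to be
  central.\<close>
lemma quaternion_centralizer:
  assumes Q: "quaternion_sub smult Q"
    and x: "x \<in> Q" "x \<notin> F" and y: "y \<in> Q" "x * y = y * x"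
  shows "\<exists>a\<in>F. \<exists>b\<in>F. y = a + b * x"
proof (rule ccontr)
  assume "\<not> ?thesis"
  then have y_notin: "y \<notin> span {x, 1}" unfolding span_1_x .
  note sub = subalgebraD[OF quaternion_sub_D(1)[OF Q]]
  obtain w where w: "w \<in> Q" "x * w \<noteq> w * x"
    using quaternion_sub_D(3)[OF Q x(1)] x(2) by metis
  let ?C = "span {y, x, 1}"
  have C_iff: "c \<in> ?C \<longleftrightarrow> (\<exists>a\<in>F. \<exists>b\<in>F. \<exists>d\<in>F. c = a + b * x + d * y)" for c
    unfolding span_insert_F[of c y] using span_1_x by (metis (no_types, lifting))
  have C_commute: "c * d = d * c" if cd: "c \<in> ?C" "d \<in> ?C" for c d
  proof -
    obtain a1 b1 d1 where 1: "a1 \<in> F" "b1 \<in> F" "d1 \<in> F" "c = a1 + b1 * x + d1 * y"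
      using cd(1) unfolding C_iff by blast
    obtain a2 b2 d2 where 2: "a2 \<in> F" "b2 \<in> F" "d2 \<in> F" "d = a2 + b2 * x + d2 * y"
      using cd(2) unfolding C_iff by blast
    have "br x y = 0" "br y x = 0" using y(2) by (simp_all add: br_eq_0_iff)
    then have "br c d = 0" unfolding 1(4) 2(4)
      using 1(1-3) 2(1-3) by (simp add: br_add br_mult br_mult_left br_F)
    then show ?thesis by (simp add: br_eq_0_iff)
  qed
  have x_C: "x \<in> ?C" and y_C: "y \<in> ?C" by (auto intro: span_base)
  have C_Q: "?C \<subseteq> Q"
    using sub x(1) y(1) unfolding subset_iff C_iff by metis
  have w_notin: "w \<notin> ?C" using C_commute[OF x_C] w(2) by metis
  have indep: "independent {w, y, x, 1}"
    using x(2) y_notin w_notin by (intro independent_insertI) (auto simp: span_1 independent_empty)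
  have card4: "card {w, y, x, 1} = 4"
  proof -
    have "w \<notin> {y, x, 1}" "y \<notin> {x, 1}" "x \<notin> {1}"
      using w_notin y_notin x(2) F_1 span_superset[of "{y,x,1}"] span_superset[of "{x,1}"] by blast+
    then show ?thesis by simp
  qed
  have span_Q: "span {w, y, x, 1} = Q"
    using indep card4 quaternion_sub_D(1,2)[OF Q] x(1) y(1) w(1) sub(3)
    by (intro independent_spans) (auto simp: subalgebra_def)
  have Q_iff: "q \<in> Q \<longleftrightarrow> (\<exists>m\<in>F. \<exists>c\<in>?C. q = c + m * w)" for q
    unfolding span_Q[symmetric] span_insert_F[of q w] by blast
  have in_C: "c \<in> ?C" if c: "c \<in> Q" "br x c = 0" for c
  proof -
    obtain m c' where mc: "m \<in> F" "c' \<in> ?C" "c = c' + m * w" using c(1) Q_iff by blast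
    have "br x c' = 0" using C_commute[OF x_C mc(2)] by (simp add: br_eq_0_iff)
    then have "m * br x w = 0" using c(2) mc by (simp add: br_add br_mult br_F)
    moreover have "br x w \<noteq> 0" using w(2) by (simp add: br_eq_0_iff)
    ultimately have "m = 0" using F_cancel mc(1) by blast
    then show ?thesis using mc by simp
  qed
  \<comment> \<open>\<open>l\<close> is the coefficient of \<open>w\<close> in \<open>x * w\<close>;
    removing it puts \<open>(x + l) * w\<close> into \<open>?C\<close>.\<close>
  obtain l c where l: "l \<in> F" "c \<in> ?C" "x * w = c + l * w"
    using sub(5)[OF x(1) w(1)] Q_iff by blast
  define z where "z = x + l"
  have z_Q: "z \<in> Q" unfolding z_def using sub x l by auto
  have z_notin: "z \<notin> F"
    using F_add[of z l] l(1) x(2) unfolding z_def by (auto simp: add.assoc)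
  have zw: "z * w = c" unfolding z_def by (simp add: l(3) c2_simps)
  have z_C: "z \<in> ?C" unfolding z_def C_iff
    using l F_0 F_1 by (intro bexI[of _ l] bexI[of _ 1] bexI[of _ 0]) (auto simp: add.commute)
  have zQ: "z * q \<in> ?C" if q: "q \<in> Q" for q
  proof -
    obtain m c' where mc: "m \<in> F" "c' \<in> ?C" "q = c' + m * w" using q Q_iff by blast
    have "z * q = z * c' + m * c"
      unfolding mc(3) by (simp add: distrib_left F_commute[OF mc(1), of z] zw
          mult.assoc[symmetric]) (simp add: mult.assoc zw)
    moreover have "br x (z * c' + m * c) = 0"
      using C_commute[OF x_C] z_C mc l br_F(2)[OF mc(1)]
      by (simp add: br_add br_mult br_eq_0_iff[THEN iffD2])
    ultimately show ?thesis using in_C sub(5)[OF z_Q q] by metis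
  qed
  \<comment> \<open>The right annihilator of the right ideal \<open>z Q\<close>. It is two-sided and
    omits 1, hence it is zero.\<close>
  define I where "I = {t \<in> Q. \<forall>q\<in>Q. z * q * t = 0}"
  have "two_sided_ideal_of Q I"
    unfolding two_sided_ideal_of_def I_def using sub
    by (auto simp: distrib_left mult.assoc) (metis mult.assoc mult_zero_left)+
  moreover have "1 \<notin> I" using z_notin F_0 sub(3) unfolding I_def by (auto intro!: bexI[of _ 1])
  ultimately have I: "I = {0}" using quaternion_sub_D(4)[OF Q] sub(3) by blast
  have "br z r = 0" if r: "r \<in> Q" for r
  proof -
    have "z * q * br z r = 0" if q: "q \<in> Q" for q
    proof -
      have "z * q * br z r = z * q * z * r + (z * (q * r)) * z"
        by (simp add: br_def c2_simps)
      also have "z * q * z = z * (z * q)"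
        using C_commute[OF zQ[OF q] z_C] .
      also have "(z * (q * r)) * z = z * (z * (q * r))"
        using C_commute[OF zQ[OF sub(5)[OF q r]] z_C] .
      finally show ?thesis by (simp add: mult.assoc)
    qed
    then have "br z r \<in> I" unfolding I_def br_def using sub z_Q r by auto
    then show ?thesis using I by simp
  qed
  then have "z \<in> F" using quaternion_sub_D(3)[OF Q z_Q] by (simp add: br_eq_0_iff)
  then show False using z_notin by blast
qed

lemma quaternion_square:
  assumes "quaternion_sub smult Q" "x \<in> Q" "x \<notin> F"
  shows "\<exists>n\<in>F. \<exists>t\<in>F. x * x = n + t * x"
  using quaternion_centralizer[OF assms, of "x * x"]
    subalgebraD(5)[OF quaternion_sub_D(1)[OF assms(1)] assms(2) assms(2)]
  by (simp add: mult.assoc)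

lemma quaternion_not_commutative:
  assumes Q: "quaternion_sub smult Q"
  obtains x y where "x \<in> Q" "y \<in> Q" "x * y \<noteq> y * x"
proof (rule ccontr)
  assume "\<not> thesis"
  then have "Q \<subseteq> F" using quaternion_sub_D(3)[OF Q] that by blast
  then have "dim Q \<le> card {1::'a}" by (intro dim_le_card) (auto simp: span_1)
  then show False using quaternion_sub_D(2)[OF Q] by simp
qed

text \<open>For \<open>v = y + \<sigma> y \<noteq> 0\<close> the trace vanishes because \<open>y\<close> and \<open>\<sigma> y\<close> have equal traces, so \<open>v\<^sup>2 \<in> F\<close>;
  \<open>\<sigma> u = u\<close> holds because \<open>F\<close> and the alternating elements meet only in \<open>0\<close>.\<close>
lemma quaternion_standard_generators:
  assumes Q: "quaternion_sub smult Q" and \<sigma>Q: "\<sigma> ` Q = Q" and orth: "orthogonal_char2 \<sigma>"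
  obtains u v where "u \<in> Q" "v \<in> Q" "\<sigma> u = u" "\<sigma> v = v" "br u v = v" "v \<noteq> 0" "v * v \<in> F"
    "u * u + u \<in> F"
    "\<And>y. y \<in> Q \<Longrightarrow> \<exists>a\<in>F. \<exists>b\<in>F. \<exists>c\<in>F. \<exists>d\<in>F. y = a + b * v + u * (c + d * v)"
proof -
  note sub = subalgebraD[OF quaternion_sub_D(1)[OF Q]]
  have \<sigma>_in: "\<sigma> y \<in> Q" if "y \<in> Q" for y using \<sigma>Q that by blast
  \<comment> \<open>Orthogonality passes from 1 to all nonzero scalars: dividing by \<open>c\<close>
    would make 1 alternating.\<close>
  have not_alt: "c = 0" if c: "c \<in> F" "c = y + \<sigma> y" for c y
  proof (rule ccontr)
    assume "c \<noteq> 0"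
    then obtain e where e: "e \<in> F" "c * e = 1" using F_inverse[OF c(1)] by blast
    then have "y * e + \<sigma> (y * e) = 1"
      using c(2) F_commute[of e "\<sigma> y"] by (simp add: distrib_right \<sigma>_F)
    then show False using orth unfolding orthogonal_char2_def by blast
  qed
  obtain y where y: "y \<in> Q" "\<sigma> y \<noteq> y"
  proof -
    obtain p q where "p \<in> Q" "q \<in> Q" "p * q \<noteq> q * p" using quaternion_not_commutative[OF Q] .
    then show thesis using that sub(5) \<sigma>_mult by metis
  qed
  define v where "v = y + \<sigma> y"
  have v_Q: "v \<in> Q" unfolding v_def using sub(4) \<sigma>_in y by auto
  have v_0: "v \<noteq> 0" using y(2) unfolding v_def by (simp add: add_eq_0_iff_char2)
  have v_sym: "\<sigma> v = v" unfolding v_def by (simp add: add.commute)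
  have v_F: "v \<notin> F" using not_alt v_0 v_def by blast
  have y_F: "y \<notin> F" using \<sigma>_F y(2) by blast
  have vv: "v * v \<in> F"
  proof -
    obtain n t where y2: "n \<in> F" "t \<in> F" "y * y = n + t * y"
      using quaternion_square[OF Q y(1) y_F] by blast
    obtain n' t' where v2: "n' \<in> F" "t' \<in> F" "v * v = n' + t' * v"
      using quaternion_square[OF Q v_Q v_F] by blast
    have "\<sigma> (y * y) = n + t * \<sigma> y"
      unfolding y2(3) using F_commute[of t] y2 \<sigma>_F by simp
    then have s2: "\<sigma> y * \<sigma> y = n + t * \<sigma> y" by simp
    \<comment> \<open>If \<open>y\<close> and \<open>\<sigma> y\<close> commute, then
      \<open>\<sigma> y = a + b * y\<close>. Applying \<open>\<sigma>\<close> again puts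
      \<open>(1 + b) * (1 + b) * y\<close> into \<open>F\<close>, so \<open>b = 1\<close> and
      \<open>v = a\<close> is a scalar.\<close>
    have "br y (\<sigma> y) \<noteq> 0"
    proof
      assume "br y (\<sigma> y) = 0"
      then obtain a b where ab: "a \<in> F" "b \<in> F" "\<sigma> y = a + b * y"
        using quaternion_centralizer[OF Q y(1) y_F \<sigma>_in[OF y(1)]] br_eq_0_iff by blast
      have "y = \<sigma> (a + b * y)" using ab(3) by (metis \<sigma>_\<sigma>)
      also have "\<dots> = a + b * (a + b * y)"
        using ab F_commute[of b] \<sigma>_F by simp
      finally have "y + b * (b * y) = a + b * a"
        unfolding add_eq_iff_char2 by (simp add: c2_simps)
      then have eq: "(1 + b) * (1 + b) * y = a + b * a" by (simp add: c2_simps)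
      have "1 + b = 0"
      proof (rule ccontr)
        assume "1 + b \<noteq> 0"
        then obtain e where e: "e \<in> F" "e * (1 + b) = 1" using F_inverse[OF F_add[OF F_1 ab(2)]] by blast
        have "e * e * ((1 + b) * (1 + b)) = e * (e * (1 + b)) * (1 + b)" by (simp add: mult.assoc)
        then have "e * e * ((1 + b) * (1 + b)) = 1" using e by simp
        then have "y = e * e * (a + b * a)" using eq by (metis mult.assoc mult_1)
        then show False using y_F F_mult F_add e ab by metis
      qed
      then have "b = 1" by (simp add: add_eq_0_iff_char2)
      then have "v = a" unfolding v_def ab(3) by (simp add: add_ac)
      then show False using v_F ab by simp
    qed
    \<comment> \<open>Here \<open>t\<close> and \<open>t'\<close> are the traces of \<open>y\<close>
      and \<open>v\<close>. Applying \<open>br y\<close> to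
      \<open>br y (\<sigma> y) = n' + t' * v + t * v\<close> yields the factor
      \<open>t' + t\<close>, while \<open>br_square\<close> yields the factor
      \<open>t\<close>.\<close>
    moreover have "t' * br y (\<sigma> y) = 0"
    proof -
      have br_yv: "br y v = br y (\<sigma> y)" unfolding v_def by (simp add: br_add)
      have "br y (\<sigma> y) = v * v + y * y + \<sigma> y * \<sigma> y"
        unfolding v_def by (simp add: br_def c2_simps)
      also have "\<dots> = n' + t' * v + t * v"
        unfolding v2(3) y2(3) s2 by (simp add: v_def c2_simps)
      finally have "br y (br y (\<sigma> y)) = (t' + t) * br y v"
        using v2 y2 by (simp add: br_add br_mult br_F distrib_right)
      moreover have "br y (br y (\<sigma> y)) = t * br y (\<sigma> y)"
        unfolding br_square[symmetric] y2(3) using y2(1,2)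
        by (simp add: br_add br_mult_left br_F)
      ultimately show ?thesis unfolding br_yv by (simp add: distrib_right add_eq_iff_char2)
    qed
    ultimately have "t' = 0" using F_cancel v2(2) by blast
    then show ?thesis using v2 by simp
  qed
  obtain e where e: "e \<in> F" "v * (v * e) = 1" "v * e * v = 1"
    using sym_inverse[OF v_sym v_0 vv] .
  have comm_v: "\<exists>a\<in>F. \<exists>b\<in>F. x = a + b * v" if "x \<in> Q" "br x v = 0" for x
    using quaternion_centralizer[OF Q v_Q v_F that(1)] that(2) by (simp add: br_eq_0_iff)
  have br_br_v: "br (br x v) v = 0" for x
    using br_square[of v x] br_F(1)[OF vv, of x] by (simp only: br_commute[of v])
  obtain w where w: "w \<in> Q" "br w v \<noteq> 0"
    using quaternion_sub_D(3)[OF Q v_Q] v_F br_eq_0_iff by metis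
  define g where "g = br w v"
  have g_Q: "g \<in> Q" unfolding g_def br_def using sub w v_Q by auto
  obtain a b where ab: "a \<in> F" "b \<in> F" "g = a + b * v"
    using comm_v[OF g_Q] br_br_v unfolding g_def by blast
  have bvv: "b * v * (b * v) = b * b * (v * v)"
    using F_commute[OF ab(2), of v] by (simp add: mult.assoc) (metis mult.assoc)
  have g_sym: "\<sigma> g = g" using ab F_commute[of b] \<sigma>_F v_sym by simp
  have gg: "g * g \<in> F"
  proof -
    have "g * g = a * a + b * b * (v * v)"
      unfolding ab(3) using bvv F_commute[OF ab(1), of "b * v"] by (simp add: c2_simps)
    then show ?thesis using ab vv F_add F_mult by simp
  qed
  obtain f where f: "f \<in> F" "g * (g * f) = 1"
    using sym_inverse[OF g_sym _ gg] w(2) unfolding g_def by metis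
  \<comment> \<open>\<open>g * f\<close> is the inverse of \<open>g = br w v\<close> and commutes
    with \<open>v\<close>, so this normalization of \<open>w\<close> gives
    \<open>br u v = v\<close>.\<close>
  define u where "u = w * (g * f * v)"
  have u_Q: "u \<in> Q" unfolding u_def using sub w g_Q f v_Q by auto
  have br_u_v: "br u v = v"
  proof -
    have "br u v = g * (g * f * v)"
      unfolding u_def using br_br_v[of w] f(1)
      by (simp add: br_mult_left br_F g_def)
    then show ?thesis using f(2) by (simp add: mult.assoc[symmetric])
  qed
  have u_F: "u \<notin> F" using br_u_v v_0 br_F by metis
  have uu: "u * u + u \<in> F"
  proof -
    obtain n t where nt: "n \<in> F" "t \<in> F" "u * u = n + t * u"
      using quaternion_square[OF Q u_Q u_F] by blast
    have "br (u * u) v = v" by (simp add: br_square br_u_v)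
    moreover have "br (u * u) v = t * v"
      unfolding nt(3) using nt(1,2) br_u_v
      by (simp add: br_add br_mult_left br_F)
    ultimately have "(t + 1) * v = 0" by (simp add: distrib_right)
    moreover have "v * (v * e) \<noteq> 0" using e by simp
    ultimately have "t + 1 = 0"
      by (metis e(2) mult.assoc mult_1_right mult_zero_left)
    then have "t = 1" by (simp add: add_eq_0_iff_char2)
    then show ?thesis using nt by (simp add: add.assoc)
  qed
  have u_sym: "\<sigma> u = u"
  proof -
    \<comment> \<open>As \<open>u + \<sigma> u\<close> commutes with \<open>v\<close>, it equals
      some \<open>a + b * v\<close>. Both \<open>a\<close> and \<open>b * (v * v)\<close> turn out
      to be alternating scalars, so \<open>not_alt\<close> kills them.\<close>
    have "br (u + \<sigma> u) v = 0"
      using \<sigma>_br[of u v] by (simp add: br_add br_u_v v_sym)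
    then obtain a b where ab: "a \<in> F" "b \<in> F" "u + \<sigma> u = a + b * v"
      using comm_v[OF sub(4)[OF u_Q \<sigma>_in[OF u_Q]]] by blast
    have \<sigma>b: "\<sigma> (b * y) = b * \<sigma> y" using ab F_commute \<sigma>_F by simp
    have "a = (u + \<sigma> u) + b * v" using ab(3) by (simp add: add.assoc)
    also have "\<dots> = (u + b * y) + \<sigma> (u + b * y)" unfolding \<sigma>_add \<sigma>b v_def by (simp add: c2_simps)
    finally have "a = 0" using not_alt ab by blast
    then have \<sigma>u: "\<sigma> u = u + b * v" using ab(3) by (metis add_0 add_self_left)
    have "u * v + \<sigma> (u * v) = br u v + v * (b * v)"
      by (simp add: \<sigma>u v_sym br_def c2_simps)
    also have "v * (b * v) = b * (v * v)" by (metis F_commute ab(2) mult.assoc)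
    finally have "b * (v * v) = (u * v + y) + \<sigma> (u * v + y)"
      unfolding \<sigma>_add br_u_v by (simp add: v_def add_ac)
    then have "b * (v * v) = 0" using not_alt[OF F_mult[OF ab(2) vv]] by blast
    then have "b = 0" using F_cancel[OF vv, of b] sym_square_nonzero[OF v_sym v_0] F_commute[OF ab(2)]
      by metis
    then show ?thesis using \<sigma>u by simp
  qed
  show thesis
  proof (rule that[OF u_Q v_Q u_sym v_sym br_u_v v_0 vv uu])
    fix y assume y: "y \<in> Q"
    have "br y v \<in> Q" unfolding br_def using sub y v_Q by auto
    then obtain a b where ab: "a \<in> F" "b \<in> F" "br y v = a + b * v"
      using comm_v br_br_v by blast
    \<comment> \<open>\<open>v * e\<close> is the inverse of \<open>v\<close>; this \<open>s\<close>
      makes \<open>y + u * s\<close> commute with \<open>v\<close>.\<close>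
    define s where "s = br y v * (v * e)"
    have s: "s = b * (v * v * e) + a * e * v"
      unfolding s_def ab(3) using F_commute[OF e(1), of v] by (simp add: distrib_right mult.assoc add.commute)
    have "s \<in> Q" unfolding s_def br_def using sub y v_Q e by auto
    then have "y + u * s \<in> Q" using sub y u_Q by auto
    moreover have "br (y + u * s) v = 0"
    proof -
      have "br s v = 0" unfolding s_def using br_br_v[of y] e(1)
        by (simp add: br_mult_left br_F)
      then have "br (y + u * s) v = br y v + v * s"
        using br_u_v by (simp add: br_add br_mult_left)
      also have "v * s = s * v" using \<open>br s v = 0\<close> by (simp add: br_eq_0_iff)
      also have "s * v = br y v" unfolding s_def using e(3) by (simp add: mult.assoc)
      finally show ?thesis by simp
    qed
    ultimately obtain c d where cd: "c \<in> F" "d \<in> F" "y + u * s = c + d * v"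
      using comm_v by blast
    then have "y = c + d * v + u * (b * (v * v * e) + a * e * v)"
      unfolding s by (metis add.assoc add_self add_0_right)
    then show "\<exists>a\<in>F. \<exists>b\<in>F. \<exists>c\<in>F. \<exists>d\<in>F. y = a + b * v + u * (c + d * v)"
      using cd ab e vv F_mult by blast
  qed
qed

section \<open>Quaternion subalgebras from symmetric generators\<close>

lemma sym_cancel:
  assumes "\<sigma> y = y" "y \<noteq> 0" "y * y \<in> F" "y * s = 0"
  shows "s = 0"
proof -
  obtain e where "y * e * y = 1" using sym_inverse[OF assms(1-3)] by metis
  then show ?thesis using assms(4) by (metis mult.assoc mult_1 mult_zero_right)
qed

text \<open>The ring \<open>F + x F\<close> is commutative, so squaring is additive on it.\<close>

lemma adjoin_F_square:
  assumes x: "\<sigma> x = x" "x * x \<in> F" and y: "y \<in> adjoin x F"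
  shows "\<sigma> y = y" "y * y \<in> F" "br x y = 0"
proof -
  obtain a b where ab: "a \<in> F" "b \<in> F" "y = a + x * b" using y unfolding adjoin_def by blast
  show "\<sigma> y = y" using ab x F_commute[of b x] by (simp add: \<sigma>_F)
  have "y * y = a * a + x * x * (b * b)"
  proof -
    have "x * b * (x * b) = x * x * (b * b)" using F_commute[OF ab(2)] by (metis mult.assoc)
    then show ?thesis using F_commute[OF ab(1), of "x * b"] by (simp add: ab(3) c2_simps)
  qed
  then show "y * y \<in> F" using ab x F_add F_mult by simp
  show "br x y = 0" using ab by (simp add: br_add br_mult br_F)
qed

text \<open>The basis is \<open>1, x, u, u * x\<close>, and the centralizer of \<open>x\<close> is
  \<open>adjoin x F\<close>. A nonzero ideal meets this centralizer because \<open>br x\<close>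
  squares to zero, and nonzero elements of the centralizer are invertible by anisotropy; this gives
  simplicity.\<close>

lemma quaternion_sub_of_generators:
  assumes u: "\<sigma> u = u" "u * u + u \<in> F" and x: "\<sigma> x = x" "x * x \<in> F" "x \<noteq> 0"
    and br: "br u x = x"
  defines "Q \<equiv> adjoin u (adjoin x F)"
  shows "quaternion_sub smult Q" "\<sigma> ` Q = Q" "x \<in> Q"
proof -
  let ?E = "adjoin x F"
  note E = adjoin_F_square[OF x(1,2)]
  have F_sub: "subalgebra smult F"
    unfolding subalgebra_iff using F_add F_mult by blast
  have E_sub: "subalgebra smult ?E"
    by (rule subalgebra_adjoin[OF F_sub, of x "x * x" 0]) (use x F_0 br_F in auto)
  note Es = subalgebraD[OF E_sub]
  have x_E: "x \<in> ?E" by (rule generator_in_adjoin[OF F_sub])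
  have br_E: "br u s \<in> ?E" if s: "s \<in> ?E" for s
  proof -
    obtain a b where "a \<in> F" "b \<in> F" "s = a + x * b" using s unfolding adjoin_def by blast
    then have "br u s = x * b" "b \<in> F" by (simp_all add: br_add br_mult br_F br)
    then show ?thesis using Es x_E by auto
  qed
  have Q_sub: "subalgebra smult Q"
    unfolding Q_def
    by (rule subalgebra_adjoin[OF E_sub, of u "u * u + u" 1]) (use u Es br_E in \<open>auto simp: add.assoc\<close>)
  note Qs = subalgebraD[OF Q_sub]
  have E_Q: "?E \<subseteq> Q" unfolding Q_def by (rule subset_adjoin[OF E_sub])
  have u_Q: "u \<in> Q" unfolding Q_def by (rule generator_in_adjoin[OF E_sub])
  show x_Q: "x \<in> Q" using E_Q x_E by blast
  have x_F: "x \<notin> F" using br x(3) br_F by metis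
  have Q_E: "t \<in> ?E" if t: "t \<in> Q" "br x t = 0" for t
  proof -
    obtain p s where ps: "p \<in> ?E" "s \<in> ?E" "t = p + u * s"
      using t(1) unfolding Q_def adjoin_def[of u] by blast
    have "x * s = 0"
      using t(2) E(3)[OF ps(1)] E(3)[OF ps(2)] br br_commute[of x u] by (simp add: ps(3) br_add br_mult)
    then have "s = 0" using sym_cancel[OF x(1,3,2)] by simp
    then show ?thesis using ps by simp
  qed
  have \<sigma>Q: "\<sigma> t \<in> Q" if t: "t \<in> Q" for t
  proof -
    obtain p s where ps: "p \<in> ?E" "s \<in> ?E" "t = p + u * s"
      using t unfolding Q_def adjoin_def[of u] by blast
    have "\<sigma> t = p + s * u" using E(1) ps u by simp
    moreover have "p \<in> Q" "s \<in> Q" using E_Q ps by auto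
    ultimately show ?thesis using Qs u_Q by simp
  qed
  then show "\<sigma> ` Q = Q" by (metis \<sigma>_\<sigma> image_subset_iff subsetI subset_antisym rev_image_eqI)
  let ?B = "{u * x, u, x, 1}"
  have span_B: "span ?B = Q"
  proof
    have "?B \<subseteq> Q" using Qs u_Q x_Q by auto
    then show "span ?B \<subseteq> Q" using Q_sub span_minimal unfolding subalgebra_def by blast
    show "Q \<subseteq> span ?B"
    proof
      fix t assume "t \<in> Q"
      then obtain a b c d where abcd: "a \<in> F" "b \<in> F" "c \<in> F" "d \<in> F" "t = a + x * b + u * (c + x * d)"
        unfolding Q_def adjoin_def by blast
      have t: "t = a + b * x + c * u + d * (u * x)"
        unfolding abcd(5) using F_commute[of b x] F_commute[of c u] F_commute[of d "u * x"] abcd(1-4)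
        by (simp add: c2_simps)
      have "a + b * x \<in> span {x, 1}" unfolding span_1_x using abcd by blast
      then have "a + b * x + c * u \<in> span {u, x, 1}" unfolding span_insert_F[of _ u] using abcd by blast
      then show "t \<in> span ?B" unfolding t span_insert_F[of _ "u * x"] using abcd by blast
    qed
  qed
  have u_notin: "u \<notin> span {x, 1}"
  proof
    assume "u \<in> span {x, 1}"
    then obtain a b where "a \<in> F" "b \<in> F" "u = a + b * x" unfolding span_1_x by blast
    then have "br u x = 0" by (simp add: br_add br_mult_left br_F)
    then show False using br x(3) by simp
  qed
  have ux_notin: "u * x \<notin> span {u, x, 1}"
  proof
    assume "u * x \<in> span {u, x, 1}"
    then obtain z c where z: "z \<in> span {x, 1}" "c \<in> F" "u * x = z + c * u"
      unfolding span_insert_F[of _ u] by blast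
    then obtain a b where abc: "a \<in> F" "b \<in> F" "c \<in> F" "u * x = a + b * x + c * u"
      unfolding span_1_x by blast
    have "br (u * x) x = x * x" by (simp add: br_mult_left br)
    moreover have "br (u * x) x = x * c"
      unfolding abc(4) using abc(1-3) br by (simp add: br_add br_mult_left br_F F_commute)
    ultimately have "x * (x + c) = 0" by (simp add: distrib_left)
    then have "x + c = 0" using sym_cancel[OF x(1,3,2)] by blast
    then have "x = c" by (simp add: add_eq_0_iff_char2)
    then show False using abc x_F by simp
  qed
  have "independent ?B"
    using x_F u_notin ux_notin by (intro independent_insertI) (auto simp: span_1 independent_empty)
  moreover have "card ?B = 4"
  proof -
    have "u * x \<notin> {u, x, 1}" "u \<notin> {x, 1}" "x \<notin> {1}"
      using ux_notin u_notin x_F F_1 span_superset[of "{u,x,1}"] span_superset[of "{x,1}"] by blast+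
    then show ?thesis by simp
  qed
  ultimately have dim: "dim Q = 4" using dim_span_eq_card_independent span_B by metis
  have center: "{z\<in>Q. \<forall>y\<in>Q. z * y = y * z} = F"
  proof
    show "F \<subseteq> {z\<in>Q. \<forall>y\<in>Q. z * y = y * z}" using Qs F_commute by auto
    show "{z\<in>Q. \<forall>y\<in>Q. z * y = y * z} \<subseteq> F"
    proof
      fix z assume "z \<in> {z\<in>Q. \<forall>y\<in>Q. z * y = y * z}"
      then have z: "z \<in> Q" "br x z = 0" "br u z = 0" using x_Q u_Q by (simp_all add: br_eq_0_iff)
      then obtain a b where ab: "a \<in> F" "b \<in> F" "z = a + x * b"
        using Q_E unfolding adjoin_def by blast
      then have "x * b = 0" using z(3) by (simp add: br_add br_mult br_F br)
      then show "z \<in> F" using ab by simp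
    qed
  qed
  have simple: "I = {0} \<or> I = Q" if I: "two_sided_ideal_of Q I" for I
  proof (cases "I = {0}")
    case False
    have I_sub: "I \<subseteq> Q" and I_mult: "\<And>s t. s \<in> Q \<Longrightarrow> t \<in> I \<Longrightarrow> s * t \<in> I \<and> t * s \<in> I"
      and I_add: "\<And>s t. s \<in> I \<Longrightarrow> t \<in> I \<Longrightarrow> s + t \<in> I" and "0 \<in> I"
      using I unfolding two_sided_ideal_of_def by blast+
    then obtain t where t: "t \<in> I" "t \<noteq> 0" using False by blast
    have "\<exists>r\<in>I. r \<in> ?E \<and> r \<noteq> 0"
    proof (cases "br x t = 0")
      case True
      then show ?thesis using t Q_E I_sub by blast
    next
      case False
      have "br x t \<in> I" unfolding br_def using I_mult[OF x_Q t(1)] I_add by blast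
      moreover have "br x (br x t) = 0"
        unfolding br_square[symmetric] using br_F x by simp
      ultimately show ?thesis using False Q_E I_sub by blast
    qed
    then obtain r where r: "r \<in> I" "r \<in> ?E" "r \<noteq> 0" by blast
    obtain e where e: "e \<in> F" "r * (r * e) = 1"
      using sym_inverse[OF E(1)[OF r(2)] r(3) E(2)[OF r(2)]] by metis
    have "r * e \<in> Q" using Qs E_Q r e by auto
    then have "1 \<in> I" using I_mult r(1) e by metis
    then have "q \<in> I" if "q \<in> Q" for q using I_mult[OF that, of 1] by simp
    then show ?thesis using I_sub by blast
  qed simp
  have "\<exists>B. finite B \<and> B \<subseteq> Q \<and> span B = Q"
    using span_B Qs u_Q x_Q by (intro exI[of _ ?B]) auto
  then show "quaternion_sub smult Q"
    unfolding quaternion_sub_def central_simple_sub_def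
    using Q_sub center dim simple by (simp add: F_def)
qed

section \<open>Anisotropy modulo alternating elements\<close>

text \<open>The \<open>u\<close>-component of \<open>\<sigma> y y = z + \<sigma> z\<close> kills the \<open>u\<close>-part of \<open>y\<close>; on the remaining component the
  term \<open>br u z1\<close> disappears after applying the operator \<open>1 + br u\<close>, as \<open>br u\<close> is idempotent.\<close>
lemma direct_adjoin:
  assumes S: "subalgebra smult S" and \<sigma>S: "\<And>s. s \<in> S \<Longrightarrow> \<sigma> s \<in> S" and direct: "direct_on S"
    and u: "\<sigma> u = u" "u * u + u \<in> F" "\<And>s. s \<in> S \<Longrightarrow> br u s \<in> S"
    and v: "\<sigma> v = v" "v \<noteq> 0" "v * v \<in> F" "br u v = v" "\<And>s. s \<in> S \<Longrightarrow> br v s = 0"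
  shows "direct_on (adjoin u S)"
  unfolding direct_on_def
proof (intro ballI impI)
  fix y z' assume y: "y \<in> adjoin u S" and z': "z' \<in> adjoin u S" and eq: "\<sigma> y * y = z' + \<sigma> z'"
  note sub = subalgebraD[OF S]
  obtain p s where ps: "p \<in> S" "s \<in> S" "y = p + u * s" using y unfolding adjoin_def by blast
  obtain q r where qr: "q \<in> S" "r \<in> S" "z' = q + u * r" using z' unfolding adjoin_def by blast
  define a where "a = u * u + u"
  have a: "a \<in> F" unfolding a_def by (rule u)
  have uu: "u * u = u + a" unfolding a_def by (simp add: add_ac)
  have D_idem: "br u (br u t) = br u t" for t
  proof -
    have "br (u * u) t = br u t" unfolding uu using a by (simp add: br_add br_F)
    then show ?thesis by (simp add: br_square)
  qed
  have \<sigma>D: "\<sigma> (br u t) = br u (\<sigma> t)" for t using \<sigma>_br[of u t] u by simp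
  \<comment> \<open>\<open>v\<close> centralizes \<open>S\<close> but not \<open>u\<close>, so the
    sum of \<open>S\<close> and \<open>u S\<close> is direct.\<close>
  have indep: "t = 0" if "t \<in> S" "u * t \<in> S" for t
  proof -
    have "br v (u * t) = v * t" using that v by (simp add: br_mult br_commute[of v u])
    then have "v * t = 0" using that v by simp
    then show ?thesis using sym_cancel v by blast
  qed
  \<comment> \<open>The cross term \<open>\<sigma> p * u * s\<close> of
    \<open>\<sigma> y * y\<close> is absorbed into \<open>z'\<close>: together they are
    \<open>z0 + u * z1\<close>.\<close>
  define z0 where "z0 = q + br u (\<sigma> p) * s"
  define z1 where "z1 = r + \<sigma> p * s"
  have z_S: "z0 \<in> S" "z1 \<in> S"
    unfolding z0_def z1_def using sub ps qr \<sigma>S u by auto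
  let ?rest = "br u (\<sigma> s) * s + a * \<sigma> s * s"
  have main: "\<sigma> p * p + u * (\<sigma> s * s) + ?rest = z0 + \<sigma> z0 + br u (\<sigma> z1) + u * (z1 + \<sigma> z1)"
  proof -
    have zz: "z0 + u * z1 = z' + \<sigma> p * u * s"
      unfolding z0_def z1_def qr(3) by (simp add: br_def c2_simps)
    have "\<sigma> p * p + \<sigma> s * (u * u) * s = \<sigma> y * y + \<sigma> p * u * s + \<sigma> (\<sigma> p * u * s)"
      unfolding ps(3) using u by (simp add: c2_simps)
    also have "\<dots> = (z0 + u * z1) + \<sigma> (z0 + u * z1)"
      unfolding zz eq by (simp add: add_ac)
    also have "\<dots> = z0 + \<sigma> z0 + br u (\<sigma> z1) + u * (z1 + \<sigma> z1)"
      using u by (simp add: br_def c2_simps)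
    also have "\<sigma> s * (u * u) * s = u * (\<sigma> s * s) + ?rest"
      unfolding uu using F_commute[OF a, of "\<sigma> s"] by (simp add: br_def c2_simps)
    finally show ?thesis by (simp add: add_ac)
  qed
  have "u * (\<sigma> s * s + z1 + \<sigma> z1) \<in> S"
  proof -
    have "u * (\<sigma> s * s + z1 + \<sigma> z1) = \<sigma> p * p + ?rest + z0 + \<sigma> z0 + br u (\<sigma> z1)"
    proof -
      have "u * (\<sigma> s * s + z1 + \<sigma> z1) = u * (\<sigma> s * s) + u * (z1 + \<sigma> z1)"
        by (simp add: c2_simps)
      also have "u * (z1 + \<sigma> z1) = (z0 + \<sigma> z0 + br u (\<sigma> z1)) + (\<sigma> p * p + u * (\<sigma> s * s) + ?rest)"
        unfolding main by (simp add: add_ac)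
      finally show ?thesis by (simp add: add_ac)
    qed
    then show ?thesis using sub ps z_S \<sigma>S u a by auto
  qed
  then have "\<sigma> s * s + z1 + \<sigma> z1 = 0" using indep sub ps z_S \<sigma>S by auto
  then have ss: "\<sigma> s * s = z1 + \<sigma> z1" by (simp add: add_eq_0_iff_char2 add.assoc)
  then have s0: "s = 0" using direct ps z_S unfolding direct_on_def by blast
  then have "z1 + \<sigma> z1 = 0" using ss by simp
  then have "\<sigma> z1 = z1" unfolding add_eq_0_iff_char2 by simp
  then have pp: "\<sigma> p * p = z0 + \<sigma> z0 + br u z1" using main s0 by simp
  \<comment> \<open>As \<open>br u\<close> is a derivation commuting with \<open>\<sigma>\<close>,
    \<open>br u (\<sigma> p * p)\<close> is \<open>t + \<sigma> t\<close> and can be moved to the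
    alternating side.\<close>
  define t where "t = \<sigma> p * br u p"
  have "\<sigma> p * p + br u (\<sigma> p * p) = (z0 + br u z0) + \<sigma> (z0 + br u z0)"
    unfolding pp by (simp add: br_add D_idem \<sigma>D add_ac)
  moreover have "br u (\<sigma> p * p) = t + \<sigma> t"
    unfolding t_def by (simp add: br_mult \<sigma>D add.commute)
  ultimately have "\<sigma> p * p + (t + \<sigma> t) = (z0 + br u z0) + \<sigma> (z0 + br u z0)"
    by simp
  then have "(t + \<sigma> t) + \<sigma> p * p = (z0 + br u z0) + \<sigma> (z0 + br u z0)"
    by (simp only: add.commute)
  then have "\<sigma> p * p = (z0 + br u z0 + t) + \<sigma> (z0 + br u z0 + t)"
    by (metis (no_types, lifting) \<sigma>_add add_self_left add.assoc add.commute add.left_commute)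
  moreover have "z0 + br u z0 + t \<in> S" unfolding t_def using sub u \<sigma>S z_S ps by auto
  ultimately have "p = 0" using direct ps unfolding direct_on_def by blast
  then show "y = 0" using ps s0 by simp
qed

end

section \<open>Towers of commuting quaternion algebras\<close>

locale quaternion_tower = char2_involution smult \<sigma>
  for smult :: "'f::field \<Rightarrow> 'a::ring_1 \<Rightarrow> 'a" and \<sigma> :: "'a \<Rightarrow> 'a" +
  fixes n :: nat and u v :: "nat \<Rightarrow> 'a"
  assumes u_sym: "i < n \<Longrightarrow> \<sigma> (u i) = u i"
    and v_sym: "i < n \<Longrightarrow> \<sigma> (v i) = v i"
    and uu: "i < n \<Longrightarrow> u i * u i + u i \<in> F"
    and vv: "i < n \<Longrightarrow> v i * v i \<in> F"
    and v_nonzero: "i < n \<Longrightarrow> v i \<noteq> 0"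
    and br_u_v: "i < n \<Longrightarrow> j < n \<Longrightarrow> br (u i) (v j) = (if i = j then v i else 0)"
    and br_u_u: "i < n \<Longrightarrow> j < n \<Longrightarrow> br (u i) (u j) = 0"
    and br_v_v: "i < n \<Longrightarrow> j < n \<Longrightarrow> br (v i) (v j) = 0"
    and generated: "subalgebra smult S \<Longrightarrow> (\<And>i. i < n \<Longrightarrow> u i \<in> S \<and> v i \<in> S) \<Longrightarrow> S = UNIV"
begin

text \<open>\<open>K_pure m\<close> is the span of the nonempty products of \<open>v\<^sub>0, \<dots>, v\<^sub>m\<^sub>-\<^sub>1\<close>; a posteriori \<open>T m\<close> is the
  centralizer of \<open>v\<^sub>m, \<dots>, v\<^sub>n\<^sub>-\<^sub>1\<close>.\<close>
primrec K :: "nat \<Rightarrow> 'a set" where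
  "K 0 = F"
| "K (Suc m) = adjoin (v m) (K m)"

primrec K_pure :: "nat \<Rightarrow> 'a set" where
  "K_pure 0 = {0}"
| "K_pure (Suc m) = {p + v m * q | p q. p \<in> K_pure m \<and> q \<in> K m}"

primrec T :: "nat \<Rightarrow> 'a set" where
  "T 0 = K n"
| "T (Suc m) = adjoin (u m) (T m)"

lemma K_SucE:
  assumes "x \<in> K (Suc m)"
  obtains p q where "p \<in> K m" "q \<in> K m" "x = p + v m * q"
  using assms unfolding K.simps adjoin_def by blast

lemma T_SucE:
  assumes "x \<in> T (Suc m)"
  obtains p q where "p \<in> T m" "q \<in> T m" "x = p + u m * q"
  using assms unfolding T.simps adjoin_def by blast

lemma br_K_0:
  assumes "\<And>i. i < m \<Longrightarrow> br z (v i) = 0" "x \<in> K m"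
  shows "br z x = 0"
  using assms
proof (induction m arbitrary: x)
  case (Suc m)
  then show ?case by (elim K_SucE) (simp add: br_add br_mult)
qed (simp add: br_F)

lemma br_v_K: "j < n \<Longrightarrow> m \<le> n \<Longrightarrow> x \<in> K m \<Longrightarrow> br (v j) x = 0"
  by (rule br_K_0[of m]) (auto intro: br_v_v)

lemma br_u_K_0: "j < n \<Longrightarrow> m \<le> j \<Longrightarrow> x \<in> K m \<Longrightarrow> br (u j) x = 0"
  by (rule br_K_0[of m]) (auto simp: br_u_v)

lemma K_commute: "m \<le> n \<Longrightarrow> x \<in> K m \<Longrightarrow> y \<in> K m \<Longrightarrow> br x y = 0"
  by (rule br_K_0[of m]) (auto simp: br_v_K br_commute[of x])

lemma K_subalgebra: "m \<le> n \<Longrightarrow> subalgebra smult (K m)"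
proof (induction m)
  case 0
  show ?case unfolding subalgebra_iff using F_add F_mult by auto
next
  case (Suc m)
  then have sub: "subalgebra smult (K m)" by simp
  note K = subalgebraD[OF sub]
  show ?case unfolding K.simps
    by (rule subalgebra_adjoin[OF sub, of "v m" "v m * v m" 0])
      (use Suc.prems K vv br_v_K[of m m] in auto)
qed

lemma K_SucI: "p \<in> K m \<Longrightarrow> q \<in> K m \<Longrightarrow> p + v m * q \<in> K (Suc m)"
  by (simp add: adjoinI)

lemma K_Suc_subset: "m \<le> n \<Longrightarrow> K m \<subseteq> K (Suc m)"
  unfolding K.simps by (rule subset_adjoin[OF K_subalgebra])

lemma K_mono: "m \<le> k \<Longrightarrow> k \<le> n \<Longrightarrow> K m \<subseteq> K k"
proof (induction k)
  case (Suc k)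
  then show ?case using K_Suc_subset[of k] by (cases "m = Suc k") auto
qed simp

lemma v_in_K: "j < m \<Longrightarrow> m \<le> n \<Longrightarrow> v j \<in> K m"
  using generator_in_adjoin[OF K_subalgebra, of j "v j"] K_mono[of "Suc j" m] by auto

text \<open>\<open>K m\<close> is commutative, so squaring is additive and only the squares of the
  \<open>v i\<close> matter. With \<open>sym_inverse\<close> this makes nonzero elements of
  \<open>K m\<close> invertible.\<close>

lemma K_sym_square: "m \<le> n \<Longrightarrow> x \<in> K m \<Longrightarrow> \<sigma> x = x \<and> x * x \<in> F"
proof (induction m arbitrary: x)
  case 0
  then show ?case by (auto simp: \<sigma>_F F_mult)
next
  case (Suc m)
  obtain p q where pq: "p \<in> K m" "q \<in> K m" "x = p + v m * q" using Suc.prems(2) by (rule K_SucE)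
  have IH: "\<sigma> p = p" "\<sigma> q = q" "p * p \<in> F" "q * q \<in> F"
    using Suc.IH Suc.prems(1) pq by auto
  have vq: "q * v m = v m * q" and vp: "v m * p = p * v m" and qp: "q * p = p * q"
    using br_v_K[of m m q] br_v_K[of m m p] K_commute[of m q p] pq Suc.prems(1) by (simp_all add: br_eq_0_iff)
  have "x * x = p * p + v m * v m * (q * q)"
  proof -
    have "p * (v m * q) = v m * (q * p)" using vp qp by (metis mult.assoc)
    moreover have "v m * (q * (v m * q)) = v m * v m * (q * q)" using vq by (metis mult.assoc)
    ultimately show ?thesis by (simp add: pq(3) c2_simps)
  qed
  then show ?case
    using IH vq v_sym[of m] vv[of m] Suc.prems(1) F_add F_mult by (simp add: pq(3))
qed

lemmas K_sym = K_sym_square[THEN conjunct1] and K_square = K_sym_square[THEN conjunct2]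

lemma br_u_K: "j < n \<Longrightarrow> m \<le> n \<Longrightarrow> x \<in> K m \<Longrightarrow> br (u j) x \<in> K m"
proof (induction m arbitrary: x)
  case 0
  then show ?case by (simp add: br_F F_0)
next
  case (Suc m)
  obtain p q where pq: "p \<in> K m" "q \<in> K m" "x = p + v m * q" using Suc.prems(3) by (rule K_SucE)
  have m: "m \<le> n" "m < n" using Suc.prems by auto
  note K = subalgebraD[OF K_subalgebra[OF m(1)]]
  have "br (u j) x = br (u j) p + v m * ((if j = m then q else 0) + br (u j) q)"
    using m Suc.prems by (simp add: pq(3) br_add br_mult br_u_v distrib_left)
  then show ?case using K_SucI Suc.IH[OF Suc.prems(1) m(1)] pq K by simp
qed

text \<open>One joint induction, since closure under products and under \<open>\<sigma>\<close> at
  \<open>Suc m\<close> relies on stability of \<open>T m\<close> under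
  \<open>br (u m)\<close>.\<close>

lemma T_props:
  assumes "m \<le> n"
  shows "subalgebra smult (T m)"
    and "j < n \<Longrightarrow> x \<in> T m \<Longrightarrow> br (u j) x \<in> T m"
    and "x \<in> T m \<Longrightarrow> \<sigma> x \<in> T m"
    and "m \<le> j \<Longrightarrow> j < n \<Longrightarrow> x \<in> T m \<Longrightarrow> br (v j) x = 0"
  using assms
proof (induction m arbitrary: x j)
  case 0
  {
    case 1 show ?case by (simp add: K_subalgebra)
  next
    case 2 then show ?case by (simp add: br_u_K)
  next
    case 3 then show ?case using K_sym[of n x] by simp
  next
    case 4 then show ?case by (auto intro: br_v_K)
  }
next
  case (Suc m)
  have IH: "subalgebra smult (T m)" "\<And>j x. j < n \<Longrightarrow> x \<in> T m \<Longrightarrow> br (u j) x \<in> T m"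
    "\<And>x. x \<in> T m \<Longrightarrow> \<sigma> x \<in> T m"
    "\<And>j x. m \<le> j \<Longrightarrow> j < n \<Longrightarrow> x \<in> T m \<Longrightarrow> br (v j) x = 0" if "m < n"
    using Suc.IH that by auto
  {
    case 1
    then have m: "m < n" by simp
    note sub = subalgebraD[OF IH(1)[OF m]]
    show ?case unfolding T.simps
      by (rule subalgebra_adjoin[OF IH(1)[OF m], of "u m" "u m * u m + u m" 1])
        (use m sub uu IH(2) in \<open>auto simp: add.assoc\<close>)
  next
    case 2
    then have m: "m < n" by simp
    obtain p q where pq: "p \<in> T m" "q \<in> T m" "x = p + u m * q" using 2(2) by (rule T_SucE)
    have "br (u j) x = br (u j) p + u m * br (u j) q"
      using m 2 by (simp add: pq(3) br_add br_mult br_u_u)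
    then show ?case using IH(2)[OF m] pq 2 by (simp add: adjoinI)
  next
    case 3
    then have m: "m < n" by simp
    note sub = subalgebraD[OF IH(1)[OF m]]
    obtain p q where pq: "p \<in> T m" "q \<in> T m" "x = p + u m * q" using 3(1) by (rule T_SucE)
    have "\<sigma> x = (\<sigma> p + br (u m) (\<sigma> q)) + u m * \<sigma> q"
      using m u_sym by (simp add: pq(3) br_def c2_simps)
    moreover have "(\<sigma> p + br (u m) (\<sigma> q)) + u m * \<sigma> q \<in> T (Suc m)"
      unfolding T.simps using sub IH(2,3)[OF m] m pq by (intro adjoinI) auto
    ultimately show ?case by simp
  next
    case 4
    then have m: "m < n" by simp
    obtain p q where pq: "p \<in> T m" "q \<in> T m" "x = p + u m * q" using 4(3) by (rule T_SucE)
    have "br (v j) (u m) = 0" using 4 m by (simp add: br_u_v br_commute[of "v j"])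
    then show ?case using IH(4)[OF m] 4 pq by (simp add: br_add br_mult)
  }
qed

lemma T_mono: "m \<le> k \<Longrightarrow> k \<le> n \<Longrightarrow> T m \<subseteq> T k"
proof (induction k)
  case (Suc k)
  then show ?case using subset_adjoin[OF T_props(1), of k "u k"] by (cases "m = Suc k") auto
qed simp

lemma T_top: "T n = UNIV"
proof (rule generated[OF T_props(1)[OF order_refl]])
  fix i assume i: "i < n"
  have "u i \<in> T (Suc i)" using generator_in_adjoin[OF T_props(1), of i] i by simp
  moreover have "v i \<in> T 0" using v_in_K i by simp
  ultimately show "u i \<in> T n \<and> v i \<in> T n" using T_mono[of "Suc i" n] T_mono[of 0 n] i by auto
qed

text \<open>Descent from \<open>T n = UNIV\<close>: the commutator of \<open>v m\<close> with
  \<open>p + u m * q\<close> is \<open>v m * q\<close>, so commuting with \<open>v m\<close> removes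
  the \<open>u m\<close>-part.\<close>

lemma centralizer_v:
  assumes "\<And>j. j < n \<Longrightarrow> br (v j) x = 0"
  shows "x \<in> K n"
proof -
  have "x \<in> K n" if "m \<le> n" "x \<in> T m" for m
    using that
  proof (induction m)
    case (Suc m)
    then have m: "m < n" by simp
    obtain p q where pq: "p \<in> T m" "q \<in> T m" "x = p + u m * q" using Suc.prems(2) by (rule T_SucE)
    have "br (v m) x = v m * q"
      using T_props(4)[of m m] m pq by (simp add: br_add br_mult br_commute[of "v m" "u m"] br_u_v)
    then have "v m * q = 0" using assms m by simp
    then have "q = 0" using sym_cancel v_sym v_nonzero vv m by blast
    then show ?case using Suc pq by simp
  qed simp
  then show ?thesis using T_top by blast
qed

text \<open>On \<open>K n\<close> the involution is trivial, so \<open>z + \<sigma> z = 0\<close>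
  and anisotropy starts the induction; \<open>direct_adjoin\<close> then adds the
  \<open>u m\<close>, with \<open>v m\<close> detecting the new component.\<close>

lemma direct_T: "m \<le> n \<Longrightarrow> direct_on (T m)"
proof (induction m)
  case 0
  have "y = 0" if yz: "y \<in> K n" "z \<in> K n" "\<sigma> y * y = z + \<sigma> z" for y z
  proof -
    have "\<sigma> y * y = 0" using yz(3) K_sym[OF order_refl yz(2)] by simp
    then show ?thesis using aniso unfolding anisotropic_def by blast
  qed
  then show ?case unfolding direct_on_def by simp
next
  case (Suc m)
  then have m: "m < n" "m \<le> n" by auto
  show ?case unfolding T.simps
    using m Suc.IH T_props[OF m(2)] u_sym uu v_sym v_nonzero vv br_u_v
    by (intro direct_adjoin[where v = "v m"]) auto
qed

text \<open>The commutator \<open>y\<close> of \<open>x\<close> with \<open>v\<^sub>j\<close> satisfies \<open>y\<^sup>2 = z + \<sigma> z\<close> for \<open>z = (x v\<^sub>j)\<^sup>2\<close>.\<close>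
lemma Sym_plus_subset_K:
  assumes x: "\<sigma> x = x" "x * x \<in> F"
  shows "x \<in> K n"
proof (rule centralizer_v)
  fix j assume j: "j < n"
  define y where "y = br (v j) x"
  have y_sym: "\<sigma> y = y" unfolding y_def using x v_sym[OF j] by (simp add: \<sigma>_br)
  define z where "z = x * v j * (x * v j)"
  \<comment> \<open>The two middle terms of \<open>y * y\<close> are equal and cancel, leaving
    \<open>z\<close> and its conjugate.\<close>
  have "v j * (x * x) * v j = x * x * (v j * v j)" using F_commute[OF x(2)] by (metis mult.assoc)
  moreover have "x * (v j * v j) * x = x * x * (v j * v j)" using F_commute[OF vv[OF j]] by (metis mult.assoc)
  ultimately have "v j * (x * x) * v j = x * (v j * v j) * x" by simp
  then have "\<sigma> y * y = z + \<sigma> z"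
    unfolding y_sym unfolding y_def z_def using x v_sym[OF j]
    by (simp add: br_def c2_simps)
  then have "y = 0" using direct_T[of n] unfolding direct_on_def T_top by blast
  then show "br (v j) x = 0" unfolding y_def .
qed

section \<open>Pure elements and the pure subform argument\<close>

lemma K_pure_subset: "m \<le> n \<Longrightarrow> K_pure m \<subseteq> K m"
proof (induction m)
  case 0
  then show ?case using F_0 by simp
next
  case (Suc m)
  then show ?case using K_SucI by fastforce
qed

text \<open>\<open>br w\<close> kills scalars, so \<open>br w x = x\<close> is unsolvable for a
  nonzero scalar \<open>x\<close>. The scalar part is therefore split off and added back at the
  end.\<close>

lemma K_pure_decomp: "m \<le> n \<Longrightarrow> x \<in> K m \<Longrightarrow> \<exists>c\<in>F. \<exists>p\<in>K_pure m. x = c + p"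
proof (induction m arbitrary: x)
  case (Suc m)
  obtain p q where pq: "p \<in> K m" "q \<in> K m" "x = p + v m * q" using Suc.prems(2) by (rule K_SucE)
  then obtain c p' where "c \<in> F" "p' \<in> K_pure m" "p = c + p'" using Suc by force
  then show ?case using pq by (intro bexI[of _ c] bexI[of _ "p' + v m * q"]) (auto simp: add.assoc)
qed simp

text \<open>The pure subform theorem: for \<open>x = p + v\<^sub>m q\<close> with \<open>p, q \<noteq> 0\<close> and \<open>w\<close> obtained for \<open>p\<close>, the
  coefficient \<open>k\<close> makes \<open>w + u\<^sub>m k\<close> commute with \<open>v\<^sub>m q\<close>.\<close>
lemma pure_generator:
  assumes "m \<le> n" "x \<in> K_pure m" "x \<noteq> 0"
  shows "\<exists>w. \<sigma> w = w \<and> w * w + w \<in> F \<and> br w x = x \<and> (\<forall>y\<in>K m. br w y \<in> K m) \<and>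
    (\<forall>j. m \<le> j \<and> j < n \<longrightarrow> br w (u j) = 0 \<and> br w (v j) = 0)"
  using assms
proof (induction m arbitrary: x)
  case (Suc m)
  then have m: "m < n" "m \<le> n" by auto
  note K = subalgebraD[OF K_subalgebra[OF m(2)]]
  obtain p q where pq: "p \<in> K_pure m" "q \<in> K m" "x = p + v m * q" using Suc.prems(2) by auto
  have p_K: "p \<in> K m" using pq K_pure_subset m by blast
  show ?case
  proof (cases "p = 0")
    case True
    then have x: "x = v m * q" using pq by simp
    have "br (u m) x = x" using br_u_K_0[of m m q] m pq by (simp add: x br_mult br_u_v)
    then show ?thesis
      using m u_sym uu br_u_K[of m "Suc m"] by (intro exI[of _ "u m"]) (auto simp: br_u_u br_u_v)
  next
    case False
    obtain w where w: "\<sigma> w = w" "w * w + w \<in> F" "br w p = p" "\<And>y. y \<in> K m \<Longrightarrow> br w y \<in> K m"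
      "\<And>j. m \<le> j \<Longrightarrow> j < n \<Longrightarrow> br w (u j) = 0" "\<And>j. m \<le> j \<Longrightarrow> j < n \<Longrightarrow> br w (v j) = 0"
      using Suc.IH[OF m(2) pq(1) False] by blast
    have D_idem: "br w (br w t) = br w t" for t
    proof -
      have "br (w * w + w) t = 0" using w br_F by blast
      then show ?thesis by (simp add: br_add br_square add_eq_0_iff_char2)
    qed
    show ?thesis
    proof (cases "q = 0")
      case True
      have "br w y \<in> K (Suc m)" if y: "y \<in> K (Suc m)" for y
      proof -
        obtain a b where ab: "a \<in> K m" "b \<in> K m" "y = a + v m * b" using y by (rule K_SucE)
        have "br w y = br w a + v m * br w b" using w m by (simp add: ab(3) br_add br_mult)
        then show ?thesis using K_SucI w ab by simp
      qed
      then show ?thesis using w True pq by (intro exI[of _ w]) auto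
    next
      case False
      obtain e where e: "e \<in> F" "q * (q * e) = 1"
        using sym_inverse[OF K_sym[OF m(2) pq(2)] False K_square[OF m(2) pq(2)]] by metis
      \<comment> \<open>\<open>k\<close> is the logarithmic derivative of \<open>q\<close> under
        \<open>br w\<close>. The shift to \<open>l = k + 1\<close> makes \<open>br w'\<close> fix
        \<open>v m * q\<close>, while \<open>br w'\<close> and \<open>br w\<close> agree on
        \<open>K m\<close>.\<close>
      define k where "k = br w q * (q * e)"
      define l where "l = k + 1"
      define w' where "w' = w + u m * l"
      have k_K: "k \<in> K m" unfolding k_def using w pq e K by auto
      have l_K: "l \<in> K m" unfolding l_def using k_K K by auto
      have comm: "br a b = 0" if "a \<in> K m" "b \<in> K m" for a b using K_commute m that by blast
      have kq: "k * q = br w q"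
      proof -
        have "k * q = br w q * (q * (q * e))"
          unfolding k_def using F_commute[OF e(1), of q] by (metis mult.assoc)
        then show ?thesis using e by simp
      qed
      \<comment> \<open>Idempotence of \<open>br w\<close> gives the Riccati-type identity
        \<open>br w k = k + k * k\<close>; replacing \<open>k\<close> by \<open>k + 1\<close>
        changes neither side.\<close>
      have br_l: "br w l = l * l + l"
      proof -
        have qek: "q * e * k = k * (q * e)" using comm[of "q * e" k] K e pq k_K by (simp add: br_eq_0_iff)
        have "br w k = br w q * (q * e) + br w q * (br w q * e)"
          unfolding k_def using e by (simp add: br_mult D_idem br_F)
        also have "br w q * (br w q * e) = k * k"
        proof -
          have "k * k = br w q * (q * e * k)" by (simp add: k_def mult.assoc)
          also have "\<dots> = br w q * (k * q * e)" unfolding qek by (simp add: mult.assoc)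
          finally show ?thesis unfolding kq by simp
        qed
        finally have "br w k = k + k * k" by (simp add: k_def)
        then show ?thesis unfolding l_def using br_F(2)[OF F_1] by (simp add: br_add c2_simps)
      qed
      have um_l: "l * u m = u m * l" using br_u_K_0[of m m l] m l_K by (simp add: br_eq_0_iff)
      have w_um: "w * u m = u m * w" using w(5)[of m] m by (simp add: br_eq_0_iff)
      have "\<sigma> w' = w'" unfolding w'_def using w u_sym m K_sym[OF m(2) l_K] um_l by simp
      \<comment> \<open>By \<open>br_l\<close> the terms \<open>u m * br w l + u m * l\<close> add
        up to \<open>u m * (l * l)\<close>, which completes the scalar
        \<open>u m * u m + u m\<close> in front of \<open>l * l\<close>.\<close>
      moreover have "w' * w' + w' = (w * w + w) + (u m * u m + u m) * (l * l)"
      proof -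
        have "w' * w' + w' = w * w + w + u m * u m * (l * l) + u m * br w l + u m * l"
        proof -
          have "w * (u m * l) = u m * (w * l)" using w_um by (metis mult.assoc)
          moreover have "u m * (l * (u m * l)) = u m * (u m * (l * l))" using um_l by (metis mult.assoc)
          ultimately show ?thesis unfolding w'_def by (simp add: br_def c2_simps)
        qed
        then show ?thesis unfolding br_l by (simp add: c2_simps)
      qed
      then have "w' * w' + w' \<in> F" using w uu m K_square[OF m(2) l_K] F_add F_mult by simp
      moreover have br_K: "br w' y = br w y" if "y \<in> K m" for y
        using br_u_K_0[of m m y] comm[OF l_K that] m that by (simp add: w'_def br_add br_mult_left)
      have br_v: "br w' (v m) = v m * l"
      proof -
        have "br l (v m) = 0" using br_v_K[of m m l] m l_K by (simp add: br_commute[of l])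
        then show ?thesis using w m by (simp add: w'_def br_add br_mult_left br_u_v)
      qed
      have "br w' x = x"
      proof -
        have "br w' x = p + v m * (l * q + br w q)"
          using br_K p_K pq w by (simp add: br_add br_mult br_v distrib_left mult.assoc)
        also have "l * q = q + br w q" unfolding l_def by (simp add: distrib_right kq add.commute)
        finally show ?thesis using pq by (simp add: add.assoc)
      qed
      moreover have "br w' y \<in> K (Suc m)" if y: "y \<in> K (Suc m)" for y
      proof -
        obtain a b where ab: "a \<in> K m" "b \<in> K m" "y = a + v m * b" using y by (rule K_SucE)
        have "br w' y = br w a + v m * (l * b + br w b)"
          using br_K ab by (simp add: br_add br_mult br_v distrib_left mult.assoc)
        then show ?thesis using K_SucI w ab l_K K by simp
      qed
      moreover have "br w' (u j) = 0 \<and> br w' (v j) = 0" if "Suc m \<le> j" "j < n" for j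
      proof -
        have "br l (u j) = 0" "br l (v j) = 0"
          using br_u_K_0[of j m l] br_v_K[of j m l] that m l_K by (simp_all add: br_commute[of l])
        then show ?thesis
          using w that m by (simp add: w'_def br_add br_mult_left br_u_u br_u_v)
      qed
      ultimately show ?thesis by blast
    qed
  qed
qed simp

end

section \<open>From a total decomposition to the invariant quaternion subalgebra\<close>

lemma totally_decomposable_tower:
  fixes smult :: "'f::field \<Rightarrow> 'a::ring_1 \<Rightarrow> 'a"
  assumes "char2_involution smult \<sigma>" "orthogonal_char2 \<sigma>" "totally_decomposable smult \<sigma>"
  obtains n u v Q where "quaternion_tower smult \<sigma> n u v" "quaternion_sub smult Q" "\<sigma> ` Q = Q"
proof -
  interpret char2_involution smult \<sigma> by (rule assms)
  obtain n Q where n: "n \<ge> (1::nat)"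
    and Q: "\<And>i. i < n \<Longrightarrow> quaternion_sub smult (Q i)" "\<And>i. i < n \<Longrightarrow> \<sigma> ` Q i = Q i"
    and comm: "\<And>i j x y. i < n \<Longrightarrow> j < n \<Longrightarrow> i \<noteq> j \<Longrightarrow> x \<in> Q i \<Longrightarrow> y \<in> Q j \<Longrightarrow> x * y = y * x"
    and gen: "generated_subalgebra smult (\<Union>i<n. Q i) = UNIV"
    using assms(3) unfolding totally_decomposable_def by metis
  define P where "P i u v \<longleftrightarrow> u \<in> Q i \<and> v \<in> Q i \<and> \<sigma> u = u \<and> \<sigma> v = v \<and> br u v = v \<and> v \<noteq> 0 \<and>
      v * v \<in> F \<and> u * u + u \<in> F \<and>
      (\<forall>y\<in>Q i. \<exists>a\<in>F. \<exists>b\<in>F. \<exists>c\<in>F. \<exists>d\<in>F. y = a + b * v + u * (c + d * v))" for i u v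
  have "\<exists>u v. P i u v" if "i < n" for i
    using quaternion_standard_generators[OF Q[OF that] assms(2)] unfolding P_def by metis
  then obtain u v where P: "\<And>i. i < n \<Longrightarrow> P i (u i) (v i)" by metis
  have "quaternion_tower smult \<sigma> n u v"
  proof unfold_locales
    fix i j assume ij: "i < n" "j < n"
    show "br (u i) (v j) = (if i = j then v i else 0)" "br (u i) (u j) = 0" "br (v i) (v j) = 0"
    proof -
      have mem: "u i \<in> Q i" "v i \<in> Q i" "u j \<in> Q j" "v j \<in> Q j" "br (u i) (v i) = v i"
        using P ij unfolding P_def by blast+
      have "br x y = 0" if "i \<noteq> j" "x \<in> Q i" "y \<in> Q j" for x y
        using comm[OF ij that] by (simp add: br_eq_0_iff)
      then show "br (u i) (v j) = (if i = j then v i else 0)" "br (u i) (u j) = 0" "br (v i) (v j) = 0"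
        using mem by (cases "i = j"; simp)+
    qed
  next
    fix S assume S: "subalgebra smult S" and uv: "\<And>i. i < n \<Longrightarrow> u i \<in> S \<and> v i \<in> S"
    have "Q i \<subseteq> S" if i: "i < n" for i
    proof
      fix y assume "y \<in> Q i"
      then obtain a b c d where "a \<in> F" "b \<in> F" "c \<in> F" "d \<in> F" "y = a + b * v i + u i * (c + d * v i)"
        using P[OF i] unfolding P_def by blast
      then show "y \<in> S" using subalgebraD[OF S] uv[OF i] by auto
    qed
    then have "generated_subalgebra smult (\<Union>i<n. Q i) \<subseteq> S"
      unfolding generated_subalgebra_def using S by blast
    then show "S = UNIV" using gen by blast
  qed (use P in \<open>auto simp: P_def\<close>)
  \<comment> \<open>As \<open>n \<ge> 1\<close>, a factor \<open>Q 0\<close> exists; it will serve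
    the case of scalar \<open>x\<close>.\<close>
  then show thesis using that Q n by (metis less_le_trans zero_less_one)
qed

theorem theorem5p1:
  fixes smult :: "'f::field \<Rightarrow> 'a::ring_1 \<Rightarrow> 'a"
    and \<sigma> :: "'a \<Rightarrow> 'a"
  assumes "CHAR('f) = 2"
    and "is_algebra smult"
    and "central_simple_sub smult UNIV"
    and "involution_first_kind smult \<sigma>"
    and "orthogonal_char2 \<sigma>"
    and "anisotropic \<sigma>"
    and "totally_decomposable smult \<sigma>"
    and "x \<in> Sym_plus smult \<sigma>"
  shows "\<exists>Q. quaternion_sub smult Q \<and> \<sigma> ` Q = Q \<and> x \<in> Q"
proof -
  have "vector_space smult" using assms(2) unfolding is_algebra_def by blast
  then have A: "char2_involution smult \<sigma>"
    using assms unfolding char2_involution_def char2_involution_axioms_def by blast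
  obtain n u v Q where tower: "quaternion_tower smult \<sigma> n u v"
    and Q: "quaternion_sub smult Q" "\<sigma> ` Q = Q"
    using totally_decomposable_tower[OF A assms(5,7)] .
  interpret quaternion_tower smult \<sigma> n u v by (rule tower)
  have "\<sigma> x = x" "x * x \<in> F"
    using assms(8) unfolding Sym_plus_def F_def by auto
  then obtain c p where cp: "c \<in> F" "p \<in> K_pure n" "x = c + p"
    using Sym_plus_subset_K K_pure_decomp by blast
  show ?thesis
  proof (cases "p = 0")
    case True
    then have "x \<in> Q" using subalgebraD(1)[OF quaternion_sub_D(1)[OF Q(1)]] cp by simp
    then show ?thesis using Q by blast
  next
    case False
    obtain w where w: "\<sigma> w = w" "w * w + w \<in> F" "br w p = p"
      using pure_generator[OF order_refl cp(2) False] by blast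
    have p: "\<sigma> p = p" "p * p \<in> F" using K_sym_square[of n p] K_pure_subset[of n] cp by auto
    note gens = quaternion_sub_of_generators[OF w(1,2) p False w(3)]
    \<comment> \<open>The subalgebra is built from the pure part \<open>p\<close> and contains all
      scalars, hence also \<open>x = c + p\<close>.\<close>
    have "x \<in> adjoin w (adjoin p F)"
      using subalgebraD[OF quaternion_sub_D(1)[OF gens(1)]] gens(3) cp by simp
    then show ?thesis using gens by blast
  qed
qed

end
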